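(* Let $d\ge1$, let $\mathcal X\subset\mathbb R^d$ be non-empty and compact, let $\|\cdot\|$ be a norm on $\mathbb R^d$, let $L>0$, and let $\varepsilon_0:=L\max_{x,y\in\mathcal X}\|x-y\|$. There is a constant $c'_d>0$ (that can be taken as $c'_d=2^{-2}2^{-7d}$) such that the sample complexity of any certified algorithm $A$ (for the constant $L$) satisfies, for every $f\in\mathcal F_L$ and all $\varepsilon\in(0,\varepsilon_0]$, $$\sigma(A,f,\varepsilon)>\frac{c'_d\,(1-\mathrm{Lip}(f)/L)^d}{1+m_\varepsilon}\,S_{\mathrm C}(f,\varepsilon),\qquad m_\varepsilon:=\lceil\log_2(\varepsilon_0/\varepsilon)\rceil.$$
   Context: For Lipschitz $f:\mathcal X\to\mathbb R$, $\mathrm{Lip}(f)$ is its smallest Lipschitz constant with respect to $\|\cdot\|$; $f$ is $L$-Lipschitz if $\mathrm{Lip}(f)\le L$; $\mathcal F_L:=\{g:\mathcal X\to\mathbb R\mid g\text{ Lipschitz and }\mathrm{Lip}(g)<L\}$. For $\varepsilon>0$, $\mathcal X_\varepsilon:=\{x\in\mathcal X:\max(f)-f(x)\le\varepsilon\}$, and for $0\le a<b$, $\mathcal X_{(a,b]}:=\{x\in\mathcal X:a<\max(f)-f(x)\le b\}$. For bounded $E\subset\mathbb R^d$ and $r>0$, the packing number is $\mathcal N(E,r):=\sup\{k\ge1:\exists x_1,\dots,x_k\in E,\ \min_{i\ne j}\|x_i-x_j\|>r\}$ if $E\neq\varnothing$, and $0$ if $E=\varnothing$. For $\varepsilon\in(0,\varepsilon_0]$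 let $m_\varepsilon:=\lceil\log_2(\varepsilon_0/\varepsilon)\rceil$, $\varepsilon_{m_\varepsilon}:=\varepsilon$, $\varepsilon_k:=\varepsilon_02^{-k}$ for $0\le k\le m_\varepsilon-1$, and $$S_{\mathrm C}(f,\varepsilon):=\mathcal N\left(\mathcal X_\varepsilon,\frac{\varepsilon}{L}\right)+\sum_{k=1}^{m_\varepsilon}\mathcal N\left(\mathcal X_{(\varepsilon_k,\varepsilon_{k-1}]},\frac{\varepsilon_k}{L}\right).$$ Certified algorithm (for $\mathcal X$, $\|\cdot\|$, $L$): a deterministic sequential procedure that, run on a function $f:\mathcal X\to\mathbb R$, at each round $n\ge1$ chooses a query point $x_n\in\mathcal X$ as a function of $f(x_1),\dots,f(x_{n-1})$ only ($x_1$ is fixed), observes $f(x_n)$, and then outputs, as functions of $f(x_1),\dots,f(x_n)$ only, a recommendation $x_n^\star\in\mathcal X$ and an error certificate $\xi_n\ge0$, subject to the constraint that for every $L$-Lipschitz $f:\mathcal X\to\mathbb R$ and every $n\ge1$, $\max(f)-f(x_n^\star)\le\xi_n$. Its sample complexity is $\sigma(A,f,\varepsilon):=\inf\{n\ge1:\xi_n\le\varepsilon\}\in\{1,2,\dots\}\cup\{+\infty\}$, where $\xi_n$ are the certificates output when $A$ is run on $f$. *)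

theory Defs
  imports "HOL-Analysis.Analysis"
begin

section \<open>Norms and Lipschitz functions\<close>

text \<open>
  The norm on \<^typ>\<open>real ^ 'd\<close> is arbitrary, not the Euclidean one carried by the type class,
  so it is an explicit parameter \<open>N\<close>. A function on the domain \<open>X\<close> is represented by a
  total function of which only the values on \<open>X\<close> are ever used.
\<close>

definition is_norm :: "('a::real_vector \<Rightarrow> real) \<Rightarrow> bool" where
  "is_norm N \<longleftrightarrow>
     (\<forall>x. 0 \<le> N x) \<and> (\<forall>x. N x = 0 \<longleftrightarrow> x = 0) \<and>
     (\<forall>a x. N (a *\<^sub>R x) = \<bar>a\<bar> * N x) \<and> (\<forall>x y. N (x + y) \<le> N x + N y)"

definition lip_consts :: "('a::real_vector \<Rightarrow> real) \<Rightarrow> 'a set \<Rightarrow> ('a \<Rightarrow> real) \<Rightarrow> real set" where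
  "lip_consts N X f = {K. 0 \<le> K \<and> (\<forall>x\<in>X. \<forall>y\<in>X. \<bar>f x - f y\<bar> \<le> K * N (x - y))}"

definition is_lipschitz :: "('a::real_vector \<Rightarrow> real) \<Rightarrow> 'a set \<Rightarrow> ('a \<Rightarrow> real) \<Rightarrow> bool" where
  "is_lipschitz N X f \<longleftrightarrow> lip_consts N X f \<noteq> {}"

text \<open>For Lipschitz \<open>f\<close> the infimum is attained, so it is the smallest Lipschitz constant.\<close>

definition Lip :: "('a::real_vector \<Rightarrow> real) \<Rightarrow> 'a set \<Rightarrow> ('a \<Rightarrow> real) \<Rightarrow> real" where
  "Lip N X f = Inf (lip_consts N X f)"

definition L_lipschitz ::
    "('a::real_vector \<Rightarrow> real) \<Rightarrow> 'a set \<Rightarrow> real \<Rightarrow> ('a \<Rightarrow> real) \<Rightarrow> bool" where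
  "L_lipschitz N X L f \<longleftrightarrow> is_lipschitz N X f \<and> Lip N X f \<le> L"

definition F_class :: "('a::real_vector \<Rightarrow> real) \<Rightarrow> 'a set \<Rightarrow> real \<Rightarrow> ('a \<Rightarrow> real) set" where
  "F_class N X L = {g. is_lipschitz N X g \<and> Lip N X g < L}"

section \<open>Layers, packing numbers and the complexity measure\<close>

text \<open>
  The two suprema below are maxima in all uses: \<open>X\<close> is non-empty and compact and the functions
  involved are Lipschitz.
\<close>

definition max_on :: "'a set \<Rightarrow> ('a \<Rightarrow> real) \<Rightarrow> real" where
  "max_on X f = (SUP x\<in>X. f x)"

definition eps0 :: "('a::real_vector \<Rightarrow> real) \<Rightarrow> 'a set \<Rightarrow> real \<Rightarrow> real" where
  "eps0 N X L = L * (SUP (x, y)\<in>X \<times> X. N (x - y))"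

definition near_opt :: "'a set \<Rightarrow> ('a \<Rightarrow> real) \<Rightarrow> real \<Rightarrow> 'a set" where
  "near_opt X f \<epsilon> = {x \<in> X. max_on X f - f x \<le> \<epsilon>}"

definition layer :: "'a set \<Rightarrow> ('a \<Rightarrow> real) \<Rightarrow> real \<Rightarrow> real \<Rightarrow> 'a set" where
  "layer X f a b = {x \<in> X. a < max_on X f - f x \<and> max_on X f - f x \<le> b}"

text \<open>
  The values are extended naturals, so the supremum is the genuine one whether or not the set of
  admissible \<open>k\<close> is bounded. For \<open>k = 1\<close> the separation condition is vacuous.
\<close>

definition packing_number :: "('a::real_vector \<Rightarrow> real) \<Rightarrow> 'a set \<Rightarrow> real \<Rightarrow> enat" where
  "packing_number N E r =
     (if E = {} then 0
      else Sup {enat k | k. 1 \<le> k \<and>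
             (\<exists>x :: nat \<Rightarrow> 'a. (\<forall>i\<in>{1..k}. x i \<in> E) \<and>
                (\<forall>i\<in>{1..k}. \<forall>j\<in>{1..k}. i \<noteq> j \<longrightarrow> r < N (x i - x j)))})"

text \<open>In the following three definitions \<open>e0\<close> stands for the initial scale and
  \<open>0 < \<epsilon> \<le> e0\<close>, so the ceiling is non-negative.\<close>

definition num_scales :: "real \<Rightarrow> real \<Rightarrow> nat" where
  "num_scales e0 \<epsilon> = nat \<lceil>log 2 (e0 / \<epsilon>)\<rceil>"

definition scale :: "real \<Rightarrow> real \<Rightarrow> nat \<Rightarrow> real" where
  "scale e0 \<epsilon> k = (if k = num_scales e0 \<epsilon> then \<epsilon> else e0 / 2 ^ k)"

definition S_C ::
    "('a::real_vector \<Rightarrow> real) \<Rightarrow> 'a set \<Rightarrow> real \<Rightarrow> ('a \<Rightarrow> real) \<Rightarrow> real \<Rightarrow> enat" where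
  "S_C N X L f \<epsilon> =
     (let e0 = eps0 N X L in
      packing_number N (near_opt X f \<epsilon>) (\<epsilon> / L) +
      (\<Sum>k = 1..num_scales e0 \<epsilon>.
         packing_number N (layer X f (scale e0 \<epsilon> k) (scale e0 \<epsilon> (k - 1))) (scale e0 \<epsilon> k / L)))"

section \<open>Certified algorithms\<close>

text \<open>
  The three components of an algorithm are functions of the list of values observed so far, in
  chronological order; the length of the list determines the round. The first query point is
  \<open>query A []\<close>.
\<close>

record 'a algorithm =
  query :: "real list \<Rightarrow> 'a"
  recommend :: "real list \<Rightarrow> 'a"
  certificate :: "real list \<Rightarrow> real"

text \<open>\<open>observations A f n\<close> is \<open>[f x\<^sub>1, \<dots>, f x\<^sub>n]\<close> when \<open>A\<close> is run on \<open>f\<close>.\<close>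

primrec observations :: "'a algorithm \<Rightarrow> ('a \<Rightarrow> real) \<Rightarrow> nat \<Rightarrow> real list" where
  "observations A f 0 = []"
| "observations A f (Suc n) = observations A f n @ [f (query A (observations A f n))]"

text \<open>Query point, recommendation and certificate at round \<open>n \<ge> 1\<close> of the run on \<open>f\<close>.\<close>

definition query_at :: "'a algorithm \<Rightarrow> ('a \<Rightarrow> real) \<Rightarrow> nat \<Rightarrow> 'a" where
  "query_at A f n = query A (observations A f (n - 1))"

definition recommend_at :: "'a algorithm \<Rightarrow> ('a \<Rightarrow> real) \<Rightarrow> nat \<Rightarrow> 'a" where
  "recommend_at A f n = recommend A (observations A f n)"

definition certificate_at :: "'a algorithm \<Rightarrow> ('a \<Rightarrow> real) \<Rightarrow> nat \<Rightarrow> real" where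
  "certificate_at A f n = certificate A (observations A f n)"

text \<open>
  The first conjunct is the typing of the procedure. It constrains only the value lists that
  arise in a run on some function, since the others never influence the procedure.
\<close>

definition certified_algorithm ::
    "('a::real_vector \<Rightarrow> real) \<Rightarrow> 'a set \<Rightarrow> real \<Rightarrow> 'a algorithm \<Rightarrow> bool" where
  "certified_algorithm N X L A \<longleftrightarrow>
     (\<forall>f. \<forall>n\<ge>1. query_at A f n \<in> X \<and> recommend_at A f n \<in> X \<and> 0 \<le> certificate_at A f n) \<and>
     (\<forall>f. L_lipschitz N X L f \<longrightarrow>
        (\<forall>n\<ge>1. max_on X f - f (recommend_at A f n) \<le> certificate_at A f n))"

text \<open>The infimum of the empty set is \<open>\<infinity>\<close>.\<close>

definition sample_complexity :: "'a algorithm \<Rightarrow> ('a \<Rightarrow> real) \<Rightarrow> real \<Rightarrow> enat" where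
  "sample_complexity A f \<epsilon> = Inf {enat n | n. 1 \<le> n \<and> certificate_at A f n \<le> \<epsilon>}"

end

theory Submission
  imports Defs
begin

text \<open>
  A certificate is only trustworthy if the recorded values rule out a hidden better point. Let
  \<open>K = Lip N X f < L\<close>, and suppose that the certificate is at most \<open>\<epsilon>\<close> at round \<open>n\<close>. Adding
  to \<open>f\<close> a cone of slope \<open>L - K\<close> and radius \<open>r\<close> around a point \<open>y\<close> keeps the function
  \<open>L\<close>-Lipschitz and raises the value at \<open>y\<close> by \<open>(L - K) r\<close>. If the cone misses all the query
  points and the recommendation, the algorithm behaves exactly as on \<open>f\<close> while its
  recommendation is worse than \<open>y\<close> by at least \<open>(L - K) r - (max f - f y)\<close>, so this quantity is
  at most \<open>\<epsilon>\<close>. Consequently, every \<open>y\<close> that is \<open>2 s\<close>-optimal for some \<open>s \<ge> \<epsilon>\<close> lies within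
  \<open>r = 7 s / (2 (L - K))\<close> of one of the at most \<open>n + 1\<close> points just named
  (lemma \<open>near_optimal_covered\<close>).

  On the other hand, a volume comparison shows that a set covered by \<open>n + 1\<close> balls of radius \<open>r\<close>
  contains at most \<open>(n + 1) (1 + 2 r L / s)\<^sup>d\<close> points that are \<open>s / L\<close>-separated (lemma
  \<open>packing_number_le_of_cover\<close>), which is at most \<open>(n + 1) (8 / (1 - K / L))\<^sup>d\<close>. All the
  \<open>1 + m\<close> sets entering the complexity measure consist of \<open>2 s\<close>-optimal points for their own
  scale \<open>s \<ge> \<epsilon>\<close>, because consecutive scales differ by a factor of at most two. Hence the
  measure is at most \<open>(1 + m) (n + 1) (8 / (1 - K / L))\<^sup>d\<close>, and \<open>n + 1 \<le> 2 n\<close> gives the lower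
  bound on \<open>n\<close>. If the certificate stays above \<open>\<epsilon>\<close> forever, the bound amounts to the finiteness
  of the measure, which follows from covering \<open>X\<close> by a single ball.
\<close>

section \<open>Norms on a Euclidean space\<close>

lemma is_normD:
  assumes "is_norm N"
  shows is_norm_nonneg: "0 \<le> N x"
    and is_norm_eq_0_iff: "N x = 0 \<longleftrightarrow> x = 0"
    and is_norm_scaleR: "N (a *\<^sub>R x) = \<bar>a\<bar> * N x"
    and is_norm_triangle: "N (x + y) \<le> N x + N y"
  using assms unfolding is_norm_def by auto

lemma is_norm_minus:
  assumes "is_norm N"
  shows "N (x - y) = N (y - x)"
  using is_norm_scaleR[OF assms, of "-1" "x - y"] by simp

lemma is_norm_triangle_sub:
  assumes "is_norm N"
  shows "N (x - z) \<le> N (x - y) + N (y - z)"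
  using is_norm_triangle[OF assms, of "x - y" "y - z"] by simp

lemma is_norm_diff_le:
  assumes "is_norm N"
  shows "\<bar>N x - N y\<bar> \<le> N (x - y)"
  using is_norm_triangle[OF assms, of "x - y" y] is_norm_triangle[OF assms, of "y - x" x]
    is_norm_minus[OF assms, of x y] by simp

lemma is_norm_sum_le:
  assumes "is_norm N" "finite I"
  shows "N (\<Sum>i\<in>I. g i) \<le> (\<Sum>i\<in>I. N (g i))"
  using assms(2)
proof (induction I rule: finite_induct)
  case empty
  show ?case using is_norm_eq_0_iff[OF assms(1), of 0] by simp
next
  case (insert i I)
  then show ?case using is_norm_triangle[OF assms(1), of "g i" "sum g I"] by simp
qed

lemma is_norm_le_norm:
  fixes N :: "'a::euclidean_space \<Rightarrow> real"
  assumes "is_norm N"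
  shows "N x \<le> (\<Sum>b\<in>Basis. N b) * norm x"
proof -
  have "N x = N (\<Sum>b\<in>Basis. (x \<bullet> b) *\<^sub>R b)" by (simp add: euclidean_representation)
  also have "\<dots> \<le> (\<Sum>b\<in>Basis. N ((x \<bullet> b) *\<^sub>R b))"
    by (rule is_norm_sum_le[OF assms]) simp
  also have "\<dots> \<le> (\<Sum>b\<in>Basis. N b * norm x)"
  proof (rule sum_mono)
    fix b :: 'a assume "b \<in> Basis"
    then show "N ((x \<bullet> b) *\<^sub>R b) \<le> N b * norm x"
      using mult_left_mono[OF Basis_le_norm is_norm_nonneg[OF assms, of b]]
      by (simp add: is_norm_scaleR[OF assms] mult.commute)
  qed
  finally show ?thesis by (simp add: sum_distrib_right)
qed

lemma is_norm_continuous_on: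
  fixes N :: "'a::euclidean_space \<Rightarrow> real"
  assumes "is_norm N"
  shows "continuous_on S N"
proof -
  let ?C = "\<Sum>b\<in>Basis. N b"
  have "?C-lipschitz_on S N"
  proof (rule lipschitz_onI)
    show "dist (N x) (N y) \<le> ?C * dist x y" for x y
      using is_norm_diff_le[OF assms, of x y] is_norm_le_norm[OF assms, of "x - y"]
      by (simp add: dist_norm)
    show "0 \<le> ?C" by (simp add: sum_nonneg is_norm_nonneg[OF assms])
  qed
  then show ?thesis by (rule lipschitz_on_continuous_on)
qed

text \<open>
  A continuous positive function has a positive minimum on the compact Euclidean unit sphere.
\<close>

lemma is_norm_ge_norm:
  fixes N :: "'a::euclidean_space \<Rightarrow> real"
  assumes "is_norm N"
  obtains m where "0 < m" "\<And>x. m * norm x \<le> N x"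
proof -
  have "sphere (0::'a) 1 \<noteq> {}" by simp
  then obtain u where u: "u \<in> sphere 0 1" "\<And>x. x \<in> sphere 0 1 \<Longrightarrow> N u \<le> N x"
    using continuous_attains_inf[OF compact_sphere _ is_norm_continuous_on[OF assms]] by blast
  have "u \<noteq> 0" using u(1) by auto
  then have pos: "0 < N u"
    using is_norm_nonneg[OF assms, of u] is_norm_eq_0_iff[OF assms, of u] by linarith
  have "N u * norm x \<le> N x" for x
  proof (cases "x = 0")
    case True
    then show ?thesis using is_norm_nonneg[OF assms] by simp
  next
    case False
    then have "N u \<le> N ((1 / norm x) *\<^sub>R x)" by (intro u(2)) simp
    then show ?thesis using False by (simp add: is_norm_scaleR[OF assms] field_simps)
  qed
  with pos show ?thesis by (rule that)
qed

lemma is_norm_bounded_on: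
  fixes N :: "'a::euclidean_space \<Rightarrow> real"
  assumes "is_norm N" "bounded X"
  obtains D where "0 \<le> D" "\<And>x. x \<in> X \<Longrightarrow> N (x - c) \<le> D"
proof -
  obtain e where e: "\<And>x. x \<in> X \<Longrightarrow> dist c x \<le> e"
    using assms(2) bounded_any_center by blast
  let ?C = "\<Sum>b\<in>Basis. N b"
  have C: "0 \<le> ?C" by (simp add: sum_nonneg is_norm_nonneg[OF assms(1)])
  have "N (x - c) \<le> ?C * \<bar>e\<bar>" if "x \<in> X" for x
  proof -
    have "N (x - c) \<le> ?C * norm (x - c)" by (rule is_norm_le_norm[OF assms(1)])
    also have "\<dots> \<le> ?C * \<bar>e\<bar>"
      using e[OF that] by (intro mult_left_mono C) (simp add: dist_norm norm_minus_commute)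
    finally show ?thesis .
  qed
  with C show ?thesis by (intro that[of "?C * \<bar>e\<bar>"]) auto
qed

section \<open>Packing numbers of sets covered by balls\<close>

text \<open>
  Balls of radius \<open>s / 2\<close> around \<open>s\<close>-separated points are disjoint, and those around points of a
  ball of radius \<open>R\<close> lie in the concentric ball of radius \<open>R + s / 2\<close>. All these balls are
  affine images of the unit ball \<open>U\<close>, so comparing volumes gives the bound.
\<close>

lemma card_separated_in_ball_le:
  fixes N :: "'a::euclidean_space \<Rightarrow> real"
  assumes N: "is_norm N" and fin: "finite P" and s: "0 < s" and R: "0 \<le> R"
    and P: "\<And>p. p \<in> P \<Longrightarrow> N (p - c) \<le> R"
    and sep: "\<And>p q. p \<in> P \<Longrightarrow> q \<in> P \<Longrightarrow> p \<noteq> q \<Longrightarrow> s < N (p - q)"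
  shows "real (card P) \<le> (1 + 2 * R / s) ^ DIM('a)"
proof -
  define U where "U = {x. N x < 1}"
  let ?b = "\<lambda>t p. (\<lambda>x. t *\<^sub>R x + p) ` U"
  have opU: "open U"
    unfolding U_def by (intro open_Collect_less is_norm_continuous_on[OF N] continuous_on_const)
  obtain m where m: "0 < m" "\<And>x. m * norm x \<le> N x"
    using is_norm_ge_norm[OF N] by blast
  have "norm x \<le> 1 / m" if "x \<in> U" for x
    using m(2)[of x] that m(1) unfolding U_def by (simp add: field_simps)
  then have bU: "bounded U" unfolding bounded_iff by blast
  have U0: "0 \<in> U" unfolding U_def using is_norm_eq_0_iff[OF N, of 0] by simp
  have Umeas: "U \<in> lmeasurable" using bU opU by (rule lmeasurable_open)
  have "\<not> negligible U" using opU U0 open_not_negligible by blast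
  then have Upos: "0 < measure lebesgue U"
    using Umeas negligible_iff_measure[of U] by (simp add: zero_less_measure_iff)
  have bmeas: "?b t p \<in> lmeasurable" if "0 < t" for t p
  proof -
    have "open (?b t p)"
    proof -
      have "?b t p = (\<lambda>x. p + x) ` ((*\<^sub>R) t ` U)" by (auto simp: image_image add.commute)
      then show ?thesis using that opU by (simp add: open_translation open_scaling)
    qed
    moreover have "bounded (?b t p)"
    proof -
      have "?b t p = (\<lambda>x. p + x) ` ((\<lambda>x. t *\<^sub>R x) ` U)" by (auto simp: image_image add.commute)
      then show ?thesis using bU by (simp add: bounded_translation bounded_scaling)
    qed
    ultimately show ?thesis by (simp add: lmeasurable_open)
  qed
  have bvol: "measure lebesgue (?b t p) = t ^ DIM('a) * measure lebesgue U" if "0 < t" for t p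
    using measure_lebesgue_affine[of t p U] that by (simp add: add.commute)
  have N_of_b: "N (z - p) < t" if "z \<in> ?b t p" "0 < t" for z t p
    using that unfolding U_def by (auto simp: is_norm_scaleR[OF N])
  have b_of_N: "z \<in> ?b t p" if "N (z - p) < t" "0 < t" for z t p
  proof
    show "z = t *\<^sub>R ((1 / t) *\<^sub>R (z - p)) + p" using that by simp
    show "(1 / t) *\<^sub>R (z - p) \<in> U" unfolding U_def using that by (simp add: is_norm_scaleR[OF N])
  qed
  have s2: "0 < s / 2" and Rs: "0 < R + s / 2" using s R by auto
  have disj: "pairwise (\<lambda>p q. disjnt (?b (s / 2) p) (?b (s / 2) q)) P"
  proof (rule pairwiseI)
    fix p q assume pq: "p \<in> P" "q \<in> P" "p \<noteq> q"
    have False if "z \<in> ?b (s / 2) p" "z \<in> ?b (s / 2) q" for z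
      using N_of_b[OF that(1) s2] N_of_b[OF that(2) s2] sep[OF pq]
        is_norm_triangle_sub[OF N, of p q z] is_norm_minus[OF N, of p z] by linarith
    then show "disjnt (?b (s / 2) p) (?b (s / 2) q)" unfolding disjnt_iff by blast
  qed
  have sub: "(\<Union>p\<in>P. ?b (s / 2) p) \<subseteq> ?b (R + s / 2) c"
  proof
    fix z assume "z \<in> (\<Union>p\<in>P. ?b (s / 2) p)"
    then obtain p where p: "p \<in> P" "z \<in> ?b (s / 2) p" by blast
    have "N (z - c) < R + s / 2"
      using N_of_b[OF p(2) s2] P[OF p(1)] is_norm_triangle_sub[OF N, of z c p] by linarith
    then show "z \<in> ?b (R + s / 2) c" using Rs by (rule b_of_N)
  qed
  have "real (card P) * ((s / 2) ^ DIM('a) * measure lebesgue U)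
      = (\<Sum>p\<in>P. measure lebesgue (?b (s / 2) p))"
    by (simp add: bvol[OF s2])
  also have "\<dots> = measure lebesgue (\<Union>p\<in>P. ?b (s / 2) p)"
    by (rule measure_UNION'[symmetric, OF fin bmeas[OF s2] disj])
  also have "\<dots> \<le> measure lebesgue (?b (R + s / 2) c)"
    using bmeas[OF s2] fin
    by (intro measure_mono_fmeasurable[OF sub _ bmeas[OF Rs]] fmeasurableD fmeasurable.finite_UN)
      auto
  also have "\<dots> = (R + s / 2) ^ DIM('a) * measure lebesgue U" by (rule bvol[OF Rs])
  finally have "real (card P) * (s / 2) ^ DIM('a) \<le> (R + s / 2) ^ DIM('a)"
    using Upos by (simp add: mult.assoc[symmetric])
  then have "real (card P) \<le> (R + s / 2) ^ DIM('a) / (s / 2) ^ DIM('a)"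
    using s2 by (subst pos_le_divide_eq) auto
  also have "\<dots> = ((R + s / 2) / (s / 2)) ^ DIM('a)" by (simp only: power_divide)
  also have "(R + s / 2) / (s / 2) = 1 + 2 * R / s" using s by (simp add: field_simps)
  finally show ?thesis .
qed

lemma packing_number_le_of_cover:
  fixes N :: "'a::euclidean_space \<Rightarrow> real"
  assumes N: "is_norm N" and C: "finite C" and s: "0 < s" and R: "0 \<le> R"
    and cover: "\<And>y. y \<in> E \<Longrightarrow> \<exists>c\<in>C. N (y - c) \<le> R"
  shows "packing_number N E s \<le> enat (nat \<lfloor>real (card C) * (1 + 2 * R / s) ^ DIM('a)\<rfloor>)"
proof -
  let ?M = "(1 + 2 * R / s) ^ DIM('a)"
  have "k \<le> nat \<lfloor>real (card C) * ?M\<rfloor>"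
    if xE: "\<forall>i\<in>{1..k}. x i \<in> E"
      and xs: "\<forall>i\<in>{1..k}. \<forall>j\<in>{1..k}. i \<noteq> j \<longrightarrow> s < N (x i - x j)" for k and x :: "nat \<Rightarrow> 'a"
  proof -
    let ?P = "x ` {1..k}"
    have N0: "N 0 = 0" using is_norm_eq_0_iff[OF N, of 0] by simp
    have "inj_on x {1..k}"
    proof (rule inj_onI, rule ccontr)
      fix i j assume "i \<in> {1..k}" "j \<in> {1..k}" "x i = x j" "i \<noteq> j"
      then have "s < N 0" using xs by (metis diff_self)
      then show False using s N0 by simp
    qed
    then have cardP: "card ?P = k" by (simp add: card_image)
    have sepP: "s < N (p - q)" if pq: "p \<in> ?P" "q \<in> ?P" "p \<noteq> q" for p q
    proof -
      obtain i where i: "p = x i" "i \<in> {1..k}" using pq(1) by (rule imageE)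
      obtain j where j: "q = x j" "j \<in> {1..k}" using pq(2) by (rule imageE)
      have "i \<noteq> j" using pq(3) i(1) j(1) by auto
      then show ?thesis using bspec[OF bspec[OF xs i(2)] j(2)] i(1) j(1) by simp
    qed
    have "?P \<subseteq> (\<Union>c\<in>C. {p \<in> ?P. N (p - c) \<le> R})"
    proof
      fix p assume p: "p \<in> ?P"
      then have "p \<in> E" using xE by auto
      then obtain c where "c \<in> C" "N (p - c) \<le> R" using cover by blast
      with p show "p \<in> (\<Union>c\<in>C. {p \<in> ?P. N (p - c) \<le> R})" by blast
    qed
    then have "card ?P \<le> card (\<Union>c\<in>C. {p \<in> ?P. N (p - c) \<le> R})"
      by (rule card_mono[rotated]) (simp add: C)
    also have "\<dots> \<le> (\<Sum>c\<in>C. card {p \<in> ?P. N (p - c) \<le> R})" by (rule card_UN_le[OF C])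
    finally have "k \<le> (\<Sum>c\<in>C. card {p \<in> ?P. N (p - c) \<le> R})" unfolding cardP .
    then have "real k \<le> (\<Sum>c\<in>C. real (card {p \<in> ?P. N (p - c) \<le> R}))"
      unfolding of_nat_sum[symmetric] by (rule of_nat_mono)
    also have "\<dots> \<le> (\<Sum>c\<in>C. ?M)"
    proof (rule sum_mono)
      fix c
      show "real (card {p \<in> ?P. N (p - c) \<le> R}) \<le> ?M"
      proof (rule card_separated_in_ball_le[OF N _ s R])
        show "finite {p \<in> ?P. N (p - c) \<le> R}" by simp
      qed (blast intro: sepP)+
    qed
    finally have "real k \<le> real (card C) * ?M" by simp
    then show ?thesis by linarith
  qed
  then have "Sup {enat k | k. 1 \<le> k \<and> (\<exists>x :: nat \<Rightarrow> 'a. (\<forall>i\<in>{1..k}. x i \<in> E) \<and>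
        (\<forall>i\<in>{1..k}. \<forall>j\<in>{1..k}. i \<noteq> j \<longrightarrow> s < N (x i - x j)))}
      \<le> enat (nat \<lfloor>real (card C) * ?M\<rfloor>)"
    by (intro Sup_least) auto
  then show ?thesis unfolding packing_number_def by simp
qed

section \<open>Scales and the complexity measure\<close>

lemma scale_bounds:
  assumes "0 < \<epsilon>" "\<epsilon> \<le> e0" and k: "1 \<le> k" "k \<le> num_scales e0 \<epsilon>"
  shows "\<epsilon> \<le> scale e0 \<epsilon> k" and "scale e0 \<epsilon> (k - 1) \<le> 2 * scale e0 \<epsilon> k"
proof -
  let ?m = "num_scales e0 \<epsilon>"
  have e0: "0 < e0" "0 < e0 / \<epsilon>" using assms by auto
  have small: "\<epsilon> \<le> e0 / 2 ^ j" if "j < ?m" for j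
  proof -
    have "real j < log 2 (e0 / \<epsilon>)" using that unfolding num_scales_def by linarith
    then have "2 ^ j < e0 / \<epsilon>" using less_log_iff[of 2 "e0 / \<epsilon>" "real j"] e0
      by (simp add: powr_realpow)
    then show ?thesis using assms by (simp add: field_simps)
  qed
  have "log 2 (e0 / \<epsilon>) \<le> real ?m" unfolding num_scales_def by linarith
  then have "e0 / \<epsilon> \<le> 2 ^ ?m" using log_le_iff[of 2 "e0 / \<epsilon>" "real ?m"] e0
    by (simp add: powr_realpow)
  then have big: "e0 / 2 ^ ?m \<le> \<epsilon>" using assms by (simp add: field_simps)
  show "\<epsilon> \<le> scale e0 \<epsilon> k" unfolding scale_def using small[of k] k by auto
  have "scale e0 \<epsilon> (k - 1) = 2 * (e0 / 2 ^ k)"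
    unfolding scale_def using k by (cases k) auto
  also have "\<dots> \<le> 2 * scale e0 \<epsilon> k" unfolding scale_def using big by auto
  finally show "scale e0 \<epsilon> (k - 1) \<le> 2 * scale e0 \<epsilon> k" .
qed

text \<open>
  Each of the \<open>1 + m\<close> sets in the complexity measure consists of points that are optimal up to
  twice the scale at which the set is packed, so a bound for such sets, uniform in the scale,
  bounds the whole measure.
\<close>

lemma S_C_le:
  assumes eps: "0 < \<epsilon>" "\<epsilon> \<le> eps0 N X L"
    and B: "\<And>s E. \<epsilon> \<le> s \<Longrightarrow> E \<subseteq> near_opt X f (2 * s) \<Longrightarrow> packing_number N E (s / L) \<le> enat B"
  shows "S_C N X L f \<epsilon> \<le> enat ((1 + num_scales (eps0 N X L) \<epsilon>) * B)"
proof -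
  let ?e = "eps0 N X L"
  let ?m = "num_scales ?e \<epsilon>"
  have 1: "packing_number N (near_opt X f \<epsilon>) (\<epsilon> / L) \<le> enat B"
    by (rule B) (use eps in \<open>auto simp: near_opt_def\<close>)
  have 2: "packing_number N (layer X f (scale ?e \<epsilon> k) (scale ?e \<epsilon> (k - 1))) (scale ?e \<epsilon> k / L)
      \<le> enat B" if "k \<in> {1..?m}" for k
  proof (rule B)
    show "\<epsilon> \<le> scale ?e \<epsilon> k" using scale_bounds(1)[OF eps] that by auto
    show "layer X f (scale ?e \<epsilon> k) (scale ?e \<epsilon> (k - 1)) \<subseteq> near_opt X f (2 * scale ?e \<epsilon> k)"
      using scale_bounds(2)[OF eps, of k] that unfolding layer_def near_opt_def by auto
  qed
  have "S_C N X L f \<epsilon> \<le> enat B + of_nat (card {1..?m}) * enat B"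
    unfolding S_C_def Let_def by (intro add_mono 1 sum_bounded_above 2)
  also have "\<dots> = enat ((1 + ?m) * B)" by (simp add: of_nat_eq_enat)
  finally show ?thesis .
qed

section \<open>Lipschitz functions\<close>

lemma Lip_le:
  assumes "0 \<le> K" "\<And>x y. x \<in> X \<Longrightarrow> y \<in> X \<Longrightarrow> \<bar>f x - f y\<bar> \<le> K * N (x - y)"
  shows "is_lipschitz N X f" and "Lip N X f \<le> K"
proof -
  have K: "K \<in> lip_consts N X f" using assms unfolding lip_consts_def by blast
  then show "is_lipschitz N X f" unfolding is_lipschitz_def by blast
  have "bdd_below (lip_consts N X f)" unfolding lip_consts_def by (rule bdd_belowI[of _ 0]) auto
  then show "Lip N X f \<le> K" unfolding Lip_def using K by (rule cInf_lower[rotated])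
qed

lemma Lip_nonneg:
  assumes "is_lipschitz N X f"
  shows "0 \<le> Lip N X f"
  using assms unfolding is_lipschitz_def Lip_def
  by (intro cInf_greatest) (auto simp: lip_consts_def)

lemma Lip_bound:
  assumes N: "is_norm N" and f: "is_lipschitz N X f" and xy: "x \<in> X" "y \<in> X"
  shows "\<bar>f x - f y\<bar> \<le> Lip N X f * N (x - y)"
proof (cases "x = y")
  case True
  then show ?thesis using is_norm_eq_0_iff[OF N, of 0] by simp
next
  case False
  then have pos: "0 < N (x - y)"
    using is_norm_nonneg[OF N, of "x - y"] is_norm_eq_0_iff[OF N, of "x - y"] by simp
  have "\<bar>f x - f y\<bar> / N (x - y) \<le> Lip N X f"
    unfolding Lip_def
  proof (rule cInf_greatest)
    show "lip_consts N X f \<noteq> {}" using f unfolding is_lipschitz_def .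
    show "\<bar>f x - f y\<bar> / N (x - y) \<le> K" if "K \<in> lip_consts N X f" for K
      using that xy pos unfolding lip_consts_def by (auto simp: pos_divide_le_eq)
  qed
  then show ?thesis using pos by (simp add: pos_divide_le_eq)
qed

lemma le_max_on:
  fixes N :: "'a::euclidean_space \<Rightarrow> real"
  assumes N: "is_norm N" and X: "bounded X" and f: "is_lipschitz N X f" and x: "x \<in> X"
  shows "f x \<le> max_on X f"
proof -
  obtain D where D: "0 \<le> D" "\<And>z. z \<in> X \<Longrightarrow> N (z - x) \<le> D"
    using is_norm_bounded_on[OF N X, where c = x] by blast
  have "f z \<le> f x + Lip N X f * D" if "z \<in> X" for z
    using Lip_bound[OF N f that x] mult_left_mono[OF D(2)[OF that] Lip_nonneg[OF f]] by linarith
  then have "bdd_above (f ` X)" by (rule bdd_aboveI2)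
  then show ?thesis unfolding max_on_def using x by (rule cSUP_upper[rotated])
qed

section \<open>Undetectable perturbations\<close>

lemma observations_cong:
  assumes "\<And>i. i \<in> {1..n} \<Longrightarrow> g (query_at A f i) = f (query_at A f i)"
  shows "observations A g n = observations A f n"
  using assms
proof (induction n)
  case (Suc n)
  have "observations A g n = observations A f n" by (rule Suc.IH) (simp add: Suc.prems)
  moreover have "g (query A (observations A f n)) = f (query A (observations A f n))"
    using Suc.prems[of "Suc n"] by (simp add: query_at_def)
  ultimately show ?case by simp
qed simp

text \<open>
  Were \<open>y\<close> at distance at least \<open>r\<close> from the first \<open>n\<close> query points and the recommendation, adding a cone with apex above
  \<open>y\<close>, radius \<open>r\<close> and slope \<open>L - Lip N X f\<close> to \<open>f\<close> would leave the run of the algorithm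
  unchanged, yet invalidate its certificate. Requiring that the recommendation is far from \<open>y\<close>
  as well keeps its value fixed, at the price of one more ball in the cover.
\<close>

lemma near_optimal_covered:
  fixes N :: "'a::euclidean_space \<Rightarrow> real"
  assumes X: "bounded X" and N: "is_norm N" and A: "certified_algorithm N X L A"
    and f: "f \<in> F_class N X L"
    and n: "1 \<le> n" "certificate_at A f n \<le> \<epsilon>"
    and y: "y \<in> near_opt X f \<delta>" and r: "\<delta> + \<epsilon> < (L - Lip N X f) * r"
  shows "\<exists>c \<in> insert (recommend_at A f n) (query_at A f ` {1..n}). N (y - c) < r"
proof (rule ccontr)
  assume "\<not> ?thesis"
  then have far: "r \<le> N (y - recommend_at A f n)"
    "\<And>i. i \<in> {1..n} \<Longrightarrow> r \<le> N (y - query_at A f i)"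
    by (auto simp: not_less)
  let ?K = "Lip N X f"
  define h where "h z = (L - ?K) * max 0 (r - N (y - z))" for z
  let ?g = "\<lambda>z. f z + h z"
  have lf: "is_lipschitz N X f" and KL: "?K < L" using f unfolding F_class_def by auto
  have K0: "0 \<le> ?K" by (rule Lip_nonneg[OF lf])
  have yX: "y \<in> X" and yd: "max_on X f - f y \<le> \<delta>" using y unfolding near_opt_def by auto
  have hlip: "\<bar>h u - h v\<bar> \<le> (L - ?K) * N (u - v)" for u v
  proof -
    have "\<bar>N (y - u) - N (y - v)\<bar> \<le> N (u - v)"
      using is_norm_diff_le[OF N, of "y - u" "y - v"] is_norm_minus[OF N, of u v] by simp
    then have "\<bar>max 0 (r - N (y - u)) - max 0 (r - N (y - v))\<bar> \<le> N (u - v)" by linarith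
    then have "(L - ?K) * \<bar>max 0 (r - N (y - u)) - max 0 (r - N (y - v))\<bar> \<le> (L - ?K) * N (u - v)"
      using KL by (intro mult_left_mono) auto
    then show ?thesis
      unfolding h_def right_diff_distrib[symmetric] abs_mult using KL by simp
  qed
  have glip: "\<bar>?g u - ?g v\<bar> \<le> L * N (u - v)" if "u \<in> X" "v \<in> X" for u v
    using Lip_bound[OF N lf that] hlip[of u v] by (simp add: left_diff_distrib)
  have g: "is_lipschitz N X ?g" "L_lipschitz N X L ?g"
    using Lip_le[where f = ?g, OF _ glip] K0 KL unfolding L_lipschitz_def by auto
  have "observations A ?g n = observations A f n"
    by (rule observations_cong) (use far(2) in \<open>simp add: h_def\<close>)
  then have same: "recommend_at A ?g n = recommend_at A f n"
    "certificate_at A ?g n = certificate_at A f n"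
    unfolding recommend_at_def certificate_at_def by auto
  have hr: "h (recommend_at A f n) = 0" unfolding h_def using far(1) by simp
  have "max_on X ?g - ?g (recommend_at A ?g n) \<le> certificate_at A ?g n"
    using A g(2) n(1) unfolding certified_algorithm_def by blast
  then have "max_on X ?g - f (recommend_at A f n) \<le> \<epsilon>"
    unfolding same using hr n(2) by simp
  moreover have "f (recommend_at A f n) \<le> max_on X f"
    using A n(1) unfolding certified_algorithm_def by (intro le_max_on[OF N X lf]) blast
  moreover have "?g y \<le> max_on X ?g" by (rule le_max_on[OF N X g(1) yX])
  moreover have "(L - ?K) * r \<le> h y"
    unfolding h_def using KL is_norm_eq_0_iff[OF N, of 0] by (intro mult_left_mono) auto
  ultimately show False using yd r by linarith
qed

section \<open>The lower bound\<close>

text \<open>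
  The radius \<open>7 s / (2 (L - K))\<close> leaves room over the threshold \<open>3 s / (L - K)\<close> of the
  perturbation argument, and makes the base of the power \<open>1 + 7 L / (L - K) \<le> 8 L / (L - K)\<close>.
\<close>

lemma S_C_le_of_certificate:
  fixes N :: "'a::euclidean_space \<Rightarrow> real"
  assumes X: "bounded X" and N: "is_norm N" and L: "0 < L"
    and A: "certified_algorithm N X L A" and f: "f \<in> F_class N X L"
    and eps: "0 < \<epsilon>" "\<epsilon> \<le> eps0 N X L"
    and n: "1 \<le> n" "certificate_at A f n \<le> \<epsilon>"
  shows "S_C N X L f \<epsilon> \<le> enat ((1 + num_scales (eps0 N X L) \<epsilon>) *
           nat \<lfloor>real (n + 1) * (8 * (L / (L - Lip N X f))) ^ DIM('a)\<rfloor>)"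
proof (rule S_C_le[OF eps])
  fix s E assume s: "\<epsilon> \<le> s" and E: "E \<subseteq> near_opt X f (2 * s)"
  let ?K = "Lip N X f"
  let ?C = "insert (recommend_at A f n) (query_at A f ` {1..n})"
  let ?q = "L / (L - ?K)"
  define r where "r = 7 / 2 * (s / (L - ?K))"
  have KL: "?K < L" and K0: "0 \<le> ?K" using f Lip_nonneg unfolding F_class_def by auto
  have s0: "0 < s" using s eps by linarith
  have r0: "0 \<le> r" unfolding r_def using s0 KL by simp
  have "a * (7 / 2 * (s / a)) = 7 / 2 * s" if "0 < a" for a using that by simp
  then have "(L - ?K) * r = 7 / 2 * s" unfolding r_def using KL by (meson diff_gt_0_iff_gt)
  then have r: "2 * s + \<epsilon> < (L - ?K) * r" using s s0 by linarith
  have "\<exists>c\<in>?C. N (y - c) \<le> r" if "y \<in> E" for y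
    using near_optimal_covered[OF X N A f n _ r] that E by (meson less_imp_le subsetD)
  then have "packing_number N E (s / L)
      \<le> enat (nat \<lfloor>real (card ?C) * (1 + 2 * r / (s / L)) ^ DIM('a)\<rfloor>)"
    using s0 L r0 by (intro packing_number_le_of_cover[OF N]) auto
  also have "\<dots> \<le> enat (nat \<lfloor>real (n + 1) * (8 * ?q) ^ DIM('a)\<rfloor>)"
  proof -
    have "card ?C \<le> Suc (card (query_at A f ` {1..n}))" by (rule card_insert_le_m1) auto
    also have "\<dots> \<le> n + 1" using card_image_le[of "{1..n}" "query_at A f"] by simp
    finally have c: "real (card ?C) \<le> real (n + 1)" by (simp only: of_nat_le_iff)
    have "2 * (7 / 2 * (s / a)) / (s / L) = 7 * (L / a)" if "0 < a" for a
      using s0 L that by (simp add: field_simps)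
    then have "2 * r / (s / L) = 7 * ?q" unfolding r_def using KL by (meson diff_gt_0_iff_gt)
    moreover have "1 \<le> ?q" using KL K0 by simp
    ultimately have b: "0 \<le> 1 + 2 * r / (s / L)" "1 + 2 * r / (s / L) \<le> 8 * ?q" by auto
    have "real (card ?C) * (1 + 2 * r / (s / L)) ^ DIM('a) \<le> real (n + 1) * (8 * ?q) ^ DIM('a)"
      using c b by (intro mult_mono power_mono) auto
    then show ?thesis by (simp only: enat_ord_simps) (intro nat_mono floor_mono)
  qed
  finally show "packing_number N E (s / L) \<le> enat (nat \<lfloor>real (n + 1) * (8 * ?q) ^ DIM('a)\<rfloor>)" .
qed

text \<open>
  A single ball covers \<open>X\<close>, and the bound that it gives is worst at the smallest scale \<open>\<epsilon>\<close>.
\<close>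

lemma S_C_finite:
  fixes N :: "'a::euclidean_space \<Rightarrow> real"
  assumes X: "bounded X" and N: "is_norm N" and L: "0 < L"
    and eps: "0 < \<epsilon>" "\<epsilon> \<le> eps0 N X L"
  shows "S_C N X L f \<epsilon> \<noteq> \<infinity>"
proof -
  obtain D where D: "0 \<le> D" "\<And>x. x \<in> X \<Longrightarrow> N (x - 0) \<le> D"
    using is_norm_bounded_on[OF N X, where c = 0] by blast
  have "S_C N X L f \<epsilon>
      \<le> enat ((1 + num_scales (eps0 N X L) \<epsilon>) * nat \<lfloor>(1 + 2 * D / (\<epsilon> / L)) ^ DIM('a)\<rfloor>)"
  proof (rule S_C_le[OF eps])
    fix s E assume s: "\<epsilon> \<le> s" and E: "E \<subseteq> near_opt X f (2 * s)"
    have s0: "0 < s" using s eps by linarith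
    have "packing_number N E (s / L)
        \<le> enat (nat \<lfloor>real (card {0::'a}) * (1 + 2 * D / (s / L)) ^ DIM('a)\<rfloor>)"
      using s0 L D E by (intro packing_number_le_of_cover[OF N]) (auto simp: near_opt_def)
    also have "\<dots> \<le> enat (nat \<lfloor>(1 + 2 * D / (\<epsilon> / L)) ^ DIM('a)\<rfloor>)"
    proof -
      have "2 * D / (s / L) \<le> 2 * D / (\<epsilon> / L)"
        using s eps L D(1) s0 by (intro divide_left_mono divide_right_mono) auto
      then have "(1 + 2 * D / (s / L)) ^ DIM('a) \<le> (1 + 2 * D / (\<epsilon> / L)) ^ DIM('a)"
        using s0 L D(1) by (intro power_mono) auto
      then show ?thesis by (simp del: times_divide_eq_right divide_divide_eq_right)
          (intro nat_mono floor_mono)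
    qed
    finally show "packing_number N E (s / L)
        \<le> enat (nat \<lfloor>(1 + 2 * D / (\<epsilon> / L)) ^ DIM('a)\<rfloor>)" .
  qed
  then show ?thesis by (cases "S_C N X L f \<epsilon>") auto
qed

lemma sample_complexity_enatD:
  assumes "sample_complexity A f \<epsilon> = enat n"
  shows "1 \<le> n" and "certificate_at A f n \<le> \<epsilon>"
proof -
  let ?S = "{enat k | k. 1 \<le> k \<and> certificate_at A f k \<le> \<epsilon>}"
  have Inf: "Inf ?S = enat n" using assms unfolding sample_complexity_def .
  have "?S \<noteq> {}"
  proof
    assume "?S = {}"
    then have "Inf ?S = \<infinity>" unfolding Inf_enat_def by (rule if_P)
    then show False using Inf by simp
  qed
  then obtain k where "k \<in> ?S" by blast
  then have "Inf ?S \<in> ?S" by (rule wellorder_InfI)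
  then show "1 \<le> n" "certificate_at A f n \<le> \<epsilon>"
    unfolding Inf by auto
qed

theorem theorem2:
  fixes X :: "(real ^ 'd) set" and N :: "real ^ 'd \<Rightarrow> real" and L :: real
    and A :: "(real ^ 'd) algorithm" and f :: "real ^ 'd \<Rightarrow> real" and \<epsilon> :: real
  assumes "X \<noteq> {}" and "compact X"
    and "is_norm N"
    and "0 < L"
    and "certified_algorithm N X L A"
    and "f \<in> F_class N X L"
    and "0 < \<epsilon>" and "\<epsilon> \<le> eps0 N X L"
  shows "ereal_of_enat (sample_complexity A f \<epsilon>) >
         ereal (1 / (2 ^ 2 * 2 ^ (7 * CARD('d))) * (1 - Lip N X f / L) ^ CARD('d)
                / (1 + real (num_scales (eps0 N X L) \<epsilon>)))
         * ereal_of_enat (S_C N X L f \<epsilon>)"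
proof -
  let ?d = "CARD('d)"
  let ?m = "num_scales (eps0 N X L) \<epsilon>"
  let ?t = "1 - Lip N X f / L"
  let ?c = "1 / (2 ^ 2 * 2 ^ (7 * ?d)) * ?t ^ ?d / (1 + real ?m)"
  have X: "bounded X" using \<open>compact X\<close> by (rule compact_imp_bounded)
  have KL: "Lip N X f < L" using \<open>f \<in> F_class N X L\<close> unfolding F_class_def by simp
  have t: "0 < ?t" using KL \<open>0 < L\<close> by simp
  have c: "0 \<le> ?c" using t by simp
  obtain S where S: "S_C N X L f \<epsilon> = enat S"
    using S_C_finite[OF X assms(3,4,7,8)] by auto
  show ?thesis
  proof (cases "sample_complexity A f \<epsilon>")
    case (enat n)
    note n = sample_complexity_enatD[OF enat]
    let ?B = "nat \<lfloor>real (n + 1) * (8 * (L / (L - Lip N X f))) ^ ?d\<rfloor>"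
    have q: "L / (L - Lip N X f) = 1 / ?t" using KL \<open>0 < L\<close> by (simp add: field_simps)
    have "S \<le> (1 + ?m) * ?B"
      using S_C_le_of_certificate[OF X assms(3-8) n] unfolding S by simp
    then have "real S \<le> real ((1 + ?m) * ?B)" by (simp only: of_nat_le_iff)
    then have "real S \<le> (1 + real ?m) * real ?B"
      by (simp only: of_nat_mult of_nat_add of_nat_1)
    also have "real ?B \<le> real (n + 1) * (8 / ?t) ^ ?d"
    proof -
      have "0 \<le> real (n + 1) * (8 / ?t) ^ ?d" using t by simp
      then show ?thesis unfolding q by (simp add: of_nat_floor)
    qed
    finally have "real S \<le> (1 + real ?m) * (real (n + 1) * (8 / ?t) ^ ?d)"
      by (simp add: mult_left_mono)
    then have "?c * real S \<le> ?c * ((1 + real ?m) * (real (n + 1) * (8 / ?t) ^ ?d))"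
      using c by (rule mult_left_mono)
    also have "\<dots> = real (n + 1) / 4 * (8 ^ ?d / 2 ^ (7 * ?d))"
    proof -
      have "1 / (2 ^ 2 * 2 ^ (7 * ?d)) * u ^ ?d / (1 + real ?m)
          * ((1 + real ?m) * (real (n + 1) * (8 / u) ^ ?d))
        = real (n + 1) / 4 * (8 ^ ?d / 2 ^ (7 * ?d))" if "0 < u" for u :: real
        using that by (simp add: power_divide add_pos_nonneg)
      then show ?thesis using t by blast
    qed
    also have "\<dots> \<le> real (n + 1) / 4 * 1"
    proof -
      have "(8::real) ^ ?d \<le> (2 ^ 7) ^ ?d" by (intro power_mono) auto
      then show ?thesis by (intro mult_left_mono) (simp_all add: power_mult)
    qed
    \<comment> \<open>Here \<open>n \<ge> 1\<close> is essential: the recommendation costs one ball beyond the \<open>n\<close> queries.\<close>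
    also have "\<dots> < real n" using n(1) by simp
    finally show ?thesis unfolding enat S by simp
  next
    case infinity
    then show ?thesis unfolding S by simp
  qed
qed

end
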